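(* Let $\Delta_1,\dots,\Delta_m\subset\{1,\dots,n\}$, let $g_i\in\mathbb{R}[x_{\Delta_i}]$ for $i=1,\dots,m$, and suppose $f_i(x_{\Delta_i})=g_i^2(x_{\Delta_i})$ and $f(x)=\sum_{i=1}^m f_i(x_{\Delta_i})$. If the polynomial system $$g_1(x_{\Delta_1})=g_2(x_{\Delta_2})=\cdots=g_m(x_{\Delta_m})=0$$ admits a real solution $x\in\mathbb{R}^n$, then the sparser SOS relaxation (with optimal value $f^*_{\Delta_s}$) is exact, i.e. $f^*_{\Delta_s}=f^*_{sos}=f^*$.
   Context: For $\Delta_i\subset\{1,\dots,n\}$, $x_{\Delta_i}=(x_j)_{j\in\Delta_i}$. For a polynomial $p$, $\mathrm{supp}(p)\subset\mathbb{N}^n$ is the set of exponents of monomials with nonzero coefficient in $p$. Let $\mathcal{G}_i$ be the set of points of $\mathbb{N}^n$ in the convex hull of $\{\alpha\in\mathbb{N}^n:2\alpha\in\mathrm{supp}(f_i)\}$, and $\mathbf{m}_{\mathcal{G}_i}(x)$ the column vector of monomials $x^\alpha$, $\alpha\in\mathcal{G}_i$. Values: $f^*=\inf_{x\in\mathbb{R}^n}f(x)$; $f^*_{sos}=\sup\{\gamma\in\mathbb{R}:f(x)-\gamma\text{ is a sum of squares of real polynomials}\}$; $f^*_{\Delta_s}=\sup\{\gamma\in\mathbb{R}: f(x)-\gamma=\sum_{i=1}^m\mathbf{m}_{\mathcal{G}_i}(x)^TW_i\,\mathbf{m}_{\mathcal{G}_i}(x)\text{ identically in }x\text{ for some real symmetric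 positive semidefinite }W_1,\dots,W_m\}$. *)

theory Defs
  imports "HOL-Analysis.Analysis" "HOL-Library.Poly_Mapping"
begin

text \<open>
  The variables are indexed by a finite type \<open>'n\<close>, which plays the role of \<open>{1,\<dots>,n}\<close>. An element
  of \<open>'n mpoly_real\<close> maps each exponent vector to its coefficient, and the ring operations of
  \<open>Poly_Mapping\<close> on this type are those of the polynomial ring (multiplication is convolution).
\<close>

type_synonym 'n expo = "'n \<Rightarrow>\<^sub>0 nat"
type_synonym 'n mpoly_real = "'n expo \<Rightarrow>\<^sub>0 real"

abbreviation supp :: "'n mpoly_real \<Rightarrow> 'n expo set" where
  "supp p \<equiv> Poly_Mapping.keys p"

definition mconst :: "real \<Rightarrow> 'n mpoly_real" where
  "mconst c = Poly_Mapping.single 0 c"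

definition mmonom :: "'n expo \<Rightarrow> 'n mpoly_real" where
  "mmonom \<alpha> = Poly_Mapping.single \<alpha> 1"

definition meval :: "'n::finite mpoly_real \<Rightarrow> real ^ 'n \<Rightarrow> real" where
  "meval p x = (\<Sum>\<alpha>\<in>supp p. Poly_Mapping.lookup p \<alpha> * (\<Prod>j\<in>UNIV. (x $ j) ^ Poly_Mapping.lookup \<alpha> j))"

text \<open>The subring of polynomials in the variables \<open>x\<^sub>j\<close> with \<open>j \<in> \<Delta>\<close>.\<close>

definition polys_in :: "'n set \<Rightarrow> 'n mpoly_real set" where
  "polys_in \<Delta> = {p. \<forall>\<alpha>\<in>supp p. Poly_Mapping.keys \<alpha> \<subseteq> \<Delta>}"

definition expo_vec :: "'n::finite expo \<Rightarrow> real ^ 'n" where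
  "expo_vec \<alpha> = (\<chi> j. real (Poly_Mapping.lookup \<alpha> j))"

text \<open>The set \<open>\<G>\<close> of a polynomial; \<open>\<alpha> + \<alpha>\<close> is the exponent vector \<open>2\<alpha>\<close>.\<close>

definition gram_expos :: "'n::finite mpoly_real \<Rightarrow> 'n expo set" where
  "gram_expos p = {\<beta>. expo_vec \<beta> \<in> convex hull (expo_vec ` {\<alpha>. \<alpha> + \<alpha> \<in> supp p})}"

text \<open>The sums over \<^const>\<open>gram_expos\<close> below are genuine because this set is finite.\<close>

lemma finite_gram_expos: "finite (gram_expos p)"
proof -
  let ?A = "{\<alpha>. \<alpha> + \<alpha> \<in> supp p}"
  have "inj_on (\<lambda>\<alpha>. \<alpha> + \<alpha>) ?A"
  proof (rule inj_onI)
    fix a b :: "'a expo" assume "a + a = b + b"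
    then have "Poly_Mapping.lookup (a + a) j = Poly_Mapping.lookup (b + b) j" for j by simp
    then show "a = b" by (intro poly_mapping_eqI) (simp add: lookup_add mult_2 [symmetric])
  qed
  then have "finite ?A"
    by (rule inj_on_finite [of _ _ "supp p"]) auto
  then have "bounded (convex hull (expo_vec ` ?A))"
    by (intro bounded_convex_hull finite_imp_bounded finite_imageI)
  then obtain B where B: "\<And>x. x \<in> convex hull (expo_vec ` ?A) \<Longrightarrow> norm x \<le> B"
    by (auto simp: bounded_iff)
  have le: "Poly_Mapping.lookup \<beta> j \<le> nat \<lceil>B\<rceil>" if "\<beta> \<in> gram_expos p" for \<beta> j
  proof -
    have "real (Poly_Mapping.lookup \<beta> j) \<le> norm (expo_vec \<beta>)"
      using component_le_norm_cart [of "expo_vec \<beta>" j] by (simp add: expo_vec_def)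
    also have "\<dots> \<le> B" using B that by (simp add: gram_expos_def)
    finally show ?thesis by linarith
  qed
  have "finite {h. \<forall>j. (j \<in> (UNIV :: 'a set) \<longrightarrow> h j \<in> {..nat \<lceil>B\<rceil>}) \<and> (j \<notin> UNIV \<longrightarrow> h j = (0::nat))}"
    by (rule finite_set_of_finite_funs) auto
  moreover have "Poly_Mapping.lookup ` gram_expos p \<subseteq>
      {h. \<forall>j. (j \<in> (UNIV :: 'a set) \<longrightarrow> h j \<in> {..nat \<lceil>B\<rceil>}) \<and> (j \<notin> UNIV \<longrightarrow> h j = 0)}"
    using le by auto
  ultimately have "finite (Poly_Mapping.lookup ` gram_expos p)"
    by (rule rev_finite_subset)
  then show ?thesis
    by (rule finite_imageD) (auto intro: inj_onI)
qed

text \<open>Matrices whose rows and columns are indexed by a finite set \<open>G\<close>; entries outside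
  \<open>G \<times> G\<close> are irrelevant.\<close>

definition sym_psd_on :: "'i set \<Rightarrow> ('i \<Rightarrow> 'i \<Rightarrow> real) \<Rightarrow> bool" where
  "sym_psd_on G W \<longleftrightarrow>
     (\<forall>a\<in>G. \<forall>b\<in>G. W a b = W b a) \<and>
     (\<forall>v :: 'i \<Rightarrow> real. (\<Sum>a\<in>G. \<Sum>b\<in>G. v a * W a b * v b) \<ge> 0)"

text \<open>The polynomial \<open>m\<^sub>G(x)\<^sup>T W m\<^sub>G(x)\<close>.\<close>

definition gram_form :: "'n expo set \<Rightarrow> ('n expo \<Rightarrow> 'n expo \<Rightarrow> real) \<Rightarrow> 'n mpoly_real" where
  "gram_form G W = (\<Sum>\<alpha>\<in>G. \<Sum>\<beta>\<in>G. mmonom \<alpha> * mconst (W \<alpha> \<beta>) * mmonom \<beta>)"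

definition is_sos :: "'n mpoly_real \<Rightarrow> bool" where
  "is_sos p \<longleftrightarrow> (\<exists>qs :: 'n mpoly_real list. p = (\<Sum>q\<leftarrow>qs. q ^ 2))"

text \<open>The optimal values are extended reals: they may be infinite for general \<open>f\<close>.\<close>

definition f_inf :: "'n::finite mpoly_real \<Rightarrow> ereal" where
  "f_inf f = (INF x. ereal (meval f x))"

definition f_sos :: "'n mpoly_real \<Rightarrow> ereal" where
  "f_sos f = (SUP \<gamma>\<in>{\<gamma>. is_sos (f - mconst \<gamma>)}. ereal \<gamma>)"

definition f_sparse_sos :: "nat \<Rightarrow> (nat \<Rightarrow> 'n::finite mpoly_real) \<Rightarrow> 'n mpoly_real \<Rightarrow> ereal" where
  "f_sparse_sos m fs f =
     (SUP \<gamma>\<in>{\<gamma>. \<exists>W. (\<forall>i\<in>{1..m}. sym_psd_on (gram_expos (fs i)) (W i)) \<and>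
                   f - mconst \<gamma> = (\<Sum>i\<in>{1..m}. gram_form (gram_expos (fs i)) (W i))}. ereal \<gamma>)"

end

theory Submission
  imports Defs
begin

text \<open>
  Both relaxations are lower bounds for \<open>f\<^sup>*\<close>, and \<open>f\<^sup>* \<le> 0\<close> because \<open>f\<close> vanishes at the common
  zero. So it suffices that \<open>\<gamma> = 0\<close> is feasible in both. For the sparser relaxation one takes
  \<open>W\<^sub>i = c\<^sub>i c\<^sub>i\<^sup>T\<close> with \<open>c\<^sub>i\<close> the coefficient vector of \<open>g\<^sub>i\<close>, which requires
  \<open>supp g\<^sub>i \<subseteq> \<G>\<^sub>i\<close>: an extreme point \<open>\<alpha>\<close> of the Newton polytope of \<open>g\<^sub>i\<close> is not a
  proper midpoint of two of its points, so \<open>2\<alpha>\<close> occurs in \<open>g\<^sub>i\<^sup>2\<close> with the nonzero coefficient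
  \<open>c\<^sub>\<alpha>\<^sup>2\<close>, and by Krein--Milman these extreme points span the polytope.
\<close>

text \<open>\<open>G\<close> may exceed the support, since the extra terms have coefficient 0. This
  lets polynomials be expanded over the whole index set of a Gram matrix.\<close>

lemma poly_mapping_eq_sum_single:
  assumes "finite G" "Poly_Mapping.keys p \<subseteq> G"
  shows "p = (\<Sum>\<alpha>\<in>G. Poly_Mapping.single \<alpha> (Poly_Mapping.lookup p \<alpha>))"
proof (rule poly_mapping_eqI)
  fix k
  have "Poly_Mapping.lookup p k = (\<Sum>\<alpha>\<in>G. if \<alpha> = k then Poly_Mapping.lookup p \<alpha> else 0)"
    using assms by (auto simp: in_keys_iff)
  then show "Poly_Mapping.lookup p k =
      Poly_Mapping.lookup (\<Sum>\<alpha>\<in>G. Poly_Mapping.single \<alpha> (Poly_Mapping.lookup p \<alpha>)) k"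
    by (simp add: lookup_sum lookup_single when_def)
qed

lemma meval_add: "meval (p + q) x = meval p x + meval q x"
  unfolding meval_def
  \<comment> \<open>Cancellation can make the support of \<open>p + q\<close> smaller than the union
    of the supports; this is harmless because each summand is additive in the coefficient and
    vanishes at coefficient 0.\<close>
  by (rule setsum_keys_plus_distrib
      [where f = "\<lambda>\<alpha> c. c * (\<Prod>j\<in>UNIV. (x $ j) ^ Poly_Mapping.lookup \<alpha> j)"])
    (simp_all add: algebra_simps)

lemma meval_0 [simp]: "meval 0 x = 0"
  by (simp add: meval_def)

lemma meval_diff: "meval (p - q) x = meval p x - meval q x"
  using meval_add [of "p - q" q x] by simp

lemma meval_sum: "meval (\<Sum>i\<in>A. p i) x = (\<Sum>i\<in>A. meval (p i) x)"
  by (induction A rule: infinite_finite_induct) (simp_all add: meval_add)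

lemma meval_single:
  "meval (Poly_Mapping.single \<alpha> c) x = c * (\<Prod>j\<in>UNIV. (x $ j) ^ Poly_Mapping.lookup \<alpha> j)"
  by (simp add: meval_def)

lemma meval_mconst [simp]: "meval (mconst c) x = c"
  by (simp add: mconst_def meval_single)

lemma meval_mult: "meval (p * q) x = meval p x * meval q x"
proof -
  have "p * q = (\<Sum>\<alpha>\<in>supp p. Poly_Mapping.single \<alpha> (Poly_Mapping.lookup p \<alpha>)) *
      (\<Sum>\<beta>\<in>supp q. Poly_Mapping.single \<beta> (Poly_Mapping.lookup q \<beta>))"
    by (simp flip: poly_mapping_eq_sum_single)
  also have "\<dots> = (\<Sum>\<alpha>\<in>supp p. \<Sum>\<beta>\<in>supp q. Poly_Mapping.single (\<alpha> + \<beta>)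
      (Poly_Mapping.lookup p \<alpha> * Poly_Mapping.lookup q \<beta>))"
    by (simp add: sum_product mult_single)
  finally show ?thesis
    by (simp add: meval_sum meval_single meval_def [of p] meval_def [of q] sum_product
        lookup_add power_add prod.distrib mult_ac)
qed

lemma meval_power2: "meval (p ^ 2) x = (meval p x) ^ 2"
  by (simp add: power2_eq_square meval_mult)

lemma meval_gram_form:
  "meval (gram_form G W) x =
    (\<Sum>\<alpha>\<in>G. \<Sum>\<beta>\<in>G. meval (mmonom \<alpha>) x * W \<alpha> \<beta> * meval (mmonom \<beta>) x)"
  by (simp add: gram_form_def meval_sum meval_mult)

lemma meval_gram_form_nonneg: "sym_psd_on G W \<Longrightarrow> 0 \<le> meval (gram_form G W) x"
  by (simp add: meval_gram_form sym_psd_on_def)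

lemma meval_sos_nonneg:
  assumes "is_sos p"
  shows "0 \<le> meval p x"
proof -
  obtain qs where "p = (\<Sum>q\<leftarrow>qs. q ^ 2)"
    using assms by (auto simp: is_sos_def)
  moreover have "0 \<le> meval (\<Sum>q\<leftarrow>qs. q ^ 2) x"
    by (induction qs) (simp_all add: meval_add meval_power2)
  ultimately show ?thesis by simp
qed

lemma is_sos_sum_squares:
  assumes "finite A"
  shows "is_sos (\<Sum>i\<in>A. (g i) ^ 2)"
proof -
  obtain xs where "set xs = A" "distinct xs"
    using finite_distinct_list [OF assms] by blast
  then have "(\<Sum>i\<in>A. (g i) ^ 2) = (\<Sum>q\<leftarrow>map g xs. q ^ 2)"
    by (simp add: sum_list_distinct_conv_sum_set comp_def)
  then show ?thesis
    unfolding is_sos_def by blast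
qed

text \<open>The quadratic form of the matrix at \<open>v\<close> is the square of the inner product
  of \<open>v\<close> and \<open>c\<close>.\<close>

lemma sym_psd_on_rank_one: "sym_psd_on G (\<lambda>a b. c a * c b)"
proof -
  have "(\<Sum>a\<in>G. \<Sum>b\<in>G. v a * (c a * c b) * v b) = (\<Sum>a\<in>G. v a * c a) ^ 2" for v
    by (simp add: power2_eq_square sum_product mult_ac)
  then show ?thesis
    by (simp add: sym_psd_on_def)
qed

lemma gram_form_rank_one:
  assumes "finite G" "supp p \<subseteq> G"
  shows "gram_form G (\<lambda>\<alpha> \<beta>. Poly_Mapping.lookup p \<alpha> * Poly_Mapping.lookup p \<beta>) = p ^ 2"
proof -
  have "p ^ 2 = (\<Sum>\<alpha>\<in>G. Poly_Mapping.single \<alpha> (Poly_Mapping.lookup p \<alpha>)) *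
      (\<Sum>\<beta>\<in>G. Poly_Mapping.single \<beta> (Poly_Mapping.lookup p \<beta>))"
    using assms by (simp add: power2_eq_square flip: poly_mapping_eq_sum_single)
  then show ?thesis
    by (simp add: gram_form_def mmonom_def mconst_def mult_single sum_product)
qed

text \<open>The coefficient is a convolution over pairs in the support with sum
  \<open>\<alpha> + \<alpha>\<close>. The hypothesis leaves at most the pair
  (\<open>\<alpha>\<close>, \<open>\<alpha>\<close>), so nothing can cancel its
  contribution.\<close>

lemma lookup_square_double:
  fixes p :: "'n mpoly_real"
  assumes "\<And>a b. a \<in> supp p \<Longrightarrow> b \<in> supp p \<Longrightarrow> a + b = \<alpha> + \<alpha> \<Longrightarrow> a = \<alpha>"
  shows "Poly_Mapping.lookup (p ^ 2) (\<alpha> + \<alpha>) = (Poly_Mapping.lookup p \<alpha>) ^ 2"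
proof -
  have "Poly_Mapping.lookup p a * (\<Sum>b. Poly_Mapping.lookup p b when \<alpha> + \<alpha> = a + b) =
      ((Poly_Mapping.lookup p \<alpha>) ^ 2 when a = \<alpha>)" for a
  proof (cases "a = \<alpha>")
    case True
    \<comment> \<open>Cancelling \<open>\<alpha>\<close> in the condition leaves only
      \<open>b = \<alpha>\<close> in the inner sum.\<close>
    then show ?thesis by (simp add: power2_eq_square)
  next
    case False
    have "(Poly_Mapping.lookup p b when \<alpha> + \<alpha> = a + b) = 0" if "a \<in> supp p" for b
      using assms [OF that, of b] False by (cases "b \<in> supp p") (auto simp: when_def in_keys_iff)
    then show ?thesis
      using False by (cases "a \<in> supp p") (simp_all add: in_keys_iff)
  qed
  then show ?thesis
    by (simp add: power2_eq_square lookup_mult)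
qed

lemma expo_vec_add: "expo_vec (\<alpha> + \<beta>) = expo_vec \<alpha> + expo_vec \<beta>"
  by (simp add: expo_vec_def vec_eq_iff lookup_add)

lemma expo_vec_inject: "expo_vec \<alpha> = expo_vec \<beta> \<longleftrightarrow> \<alpha> = \<beta>"
  by (auto simp: expo_vec_def vec_eq_iff intro: poly_mapping_eqI)

lemma supp_subset_gram_expos_square:
  fixes p :: "'n::finite mpoly_real"
  shows "supp p \<subseteq> gram_expos (p ^ 2)"
proof
  fix \<beta> assume "\<beta> \<in> supp p"
  let ?P = "convex hull (expo_vec ` supp p)"
  have "{v. v extreme_point_of ?P} \<subseteq> expo_vec ` {\<alpha>. \<alpha> + \<alpha> \<in> supp (p ^ 2)}"
  proof
    fix v assume "v \<in> {v. v extreme_point_of ?P}"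
    then have v: "v extreme_point_of ?P" by simp
    \<comment> \<open>Every extreme point of a convex hull belongs to the generating set.\<close>
    then obtain \<alpha> where \<alpha>: "\<alpha> \<in> supp p" "v = expo_vec \<alpha>"
      using extreme_point_of_convex_hull by blast
    have "a = \<alpha>" if "a \<in> supp p" "b \<in> supp p" "a + b = \<alpha> + \<alpha>" for a b
    proof -
      have "expo_vec a + expo_vec b = v + v"
        using that(3) \<alpha>(2) by (metis expo_vec_add)
      then have mid: "midpoint (expo_vec a) (expo_vec b) = v"
        by (simp add: midpoint_def flip: scaleR_2)
      have "expo_vec a \<in> ?P" "expo_vec b \<in> ?P"
        using that by (auto intro: hull_inc)
      then have "v \<notin> open_segment (expo_vec a) (expo_vec b)"
        using v by (auto simp: extreme_point_of_def)
      \<comment> \<open>Were the two points distinct, their midpoint \<open>v\<close> would lie in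
        the open segment.\<close>
      then have "expo_vec a = expo_vec b"
        using mid midpoint_in_open_segment by blast
      then show ?thesis
        using mid \<alpha>(2) by (simp add: expo_vec_inject)
    qed
    then have "Poly_Mapping.lookup (p ^ 2) (\<alpha> + \<alpha>) = (Poly_Mapping.lookup p \<alpha>) ^ 2"
      by (rule lookup_square_double)
    then have "\<alpha> + \<alpha> \<in> supp (p ^ 2)"
      using \<alpha>(1) by (simp add: in_keys_iff)
    then show "v \<in> expo_vec ` {\<alpha>. \<alpha> + \<alpha> \<in> supp (p ^ 2)}"
      using \<alpha>(2) by blast
  qed
  then have "convex hull {v. v extreme_point_of ?P} \<subseteq>
      convex hull (expo_vec ` {\<alpha>. \<alpha> + \<alpha> \<in> supp (p ^ 2)})"
    by (rule hull_mono)
  \<comment> \<open>The support is finite, so its hull is compact, as Krein-Milman requires.\<close>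
  moreover have "?P = convex hull {v. v extreme_point_of ?P}"
    by (intro Krein_Milman_Minkowski finite_imp_compact_convex_hull) simp_all
  moreover have "expo_vec \<beta> \<in> ?P"
    using \<open>\<beta> \<in> supp p\<close> by (auto intro: hull_inc)
  ultimately show "\<beta> \<in> gram_expos (p ^ 2)"
    by (auto simp: gram_expos_def)
qed

lemma f_sos_le_f_inf: "f_sos f \<le> f_inf f"
  unfolding f_sos_def f_inf_def
proof (intro SUP_least INF_greatest)
  fix \<gamma> x assume "\<gamma> \<in> {\<gamma>. is_sos (f - mconst \<gamma>)}"
  then have "0 \<le> meval (f - mconst \<gamma>) x"
    by (auto intro: meval_sos_nonneg)
  then show "ereal \<gamma> \<le> ereal (meval f x)"
    by (simp add: meval_diff)
qed

text \<open>Positive semidefiniteness makes each Gram form nonnegative at every point, so the bound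
  follows directly by evaluation, without factoring the matrices into sums of squares.\<close>

lemma f_sparse_sos_le_f_inf: "f_sparse_sos m fs f \<le> f_inf f"
  unfolding f_sparse_sos_def f_inf_def
proof (intro SUP_least INF_greatest, clarify)
  fix \<gamma> x W
  assume "\<forall>i\<in>{1..m}. sym_psd_on (gram_expos (fs i)) (W i)"
    and eq: "f - mconst \<gamma> = (\<Sum>i\<in>{1..m}. gram_form (gram_expos (fs i)) (W i))"
  then have "0 \<le> meval (f - mconst \<gamma>) x"
    unfolding eq meval_sum by (auto intro!: sum_nonneg meval_gram_form_nonneg)
  then show "ereal \<gamma> \<le> ereal (meval f x)"
    by (simp add: meval_diff)
qed

theorem theorem3p16:
  fixes \<Delta> :: "nat \<Rightarrow> 'n::finite set"
    and g fs :: "nat \<Rightarrow> 'n mpoly_real"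
    and f :: "'n mpoly_real"
    and m :: nat
  assumes "\<And>i. i \<in> {1..m} \<Longrightarrow> g i \<in> polys_in (\<Delta> i)"
    and "\<And>i. i \<in> {1..m} \<Longrightarrow> fs i = (g i) ^ 2"
    and "f = (\<Sum>i\<in>{1..m}. fs i)"
    and "\<exists>x :: real ^ 'n. \<forall>i\<in>{1..m}. meval (g i) x = 0"
  shows "f_sparse_sos m fs f = f_sos f \<and> f_sos f = f_inf f"
proof -
  have f: "f = (\<Sum>i\<in>{1..m}. (g i) ^ 2)"
    using assms(2,3) by simp
  obtain x :: "real ^ 'n" where "\<And>i. i \<in> {1..m} \<Longrightarrow> meval (g i) x = 0"
    using assms(4) by blast
  then have "meval f x = 0"
    by (simp add: f meval_sum meval_power2)
  then have inf: "f_inf f \<le> 0"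
    unfolding f_inf_def by (metis INF_lower UNIV_I zero_ereal_def)
  have diff0: "p - mconst 0 = p" for p :: "'n mpoly_real"
    by (simp add: mconst_def)
  have "is_sos (f - mconst 0)"
    unfolding diff0 f by (rule is_sos_sum_squares) simp
  then have sos: "0 \<le> f_sos f"
    unfolding f_sos_def zero_ereal_def by (intro SUP_upper) simp
  define W where "W i \<alpha> \<beta> = Poly_Mapping.lookup (g i) \<alpha> * Poly_Mapping.lookup (g i) \<beta>" for i \<alpha> \<beta>
  have "sym_psd_on (gram_expos (fs i)) (W i)" for i
    unfolding W_def by (rule sym_psd_on_rank_one)
  moreover have "f - mconst 0 = (\<Sum>i\<in>{1..m}. gram_form (gram_expos (fs i)) (W i))"
    unfolding diff0 f W_def
    using assms(2)
    by (auto intro!: sum.cong gram_form_rank_one [symmetric] finite_gram_expos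
        subsetD [OF supp_subset_gram_expos_square])
  ultimately have sparse: "0 \<le> f_sparse_sos m fs f"
    unfolding f_sparse_sos_def zero_ereal_def by (intro SUP_upper) blast
  show ?thesis
    \<comment> \<open>Both relaxation values lie between 0 and \<open>f_inf f\<close>, which is at
      most 0, so all three are equal.\<close>
    using inf sos sparse f_sos_le_f_inf [of f] f_sparse_sos_le_f_inf [of m fs f]
    by (meson order.antisym order.trans)
qed

end
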